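(* For each reflexive or irreflexive ultrahomogeneous binary structure $\mathbb{X}$, either $\mathbb{X}$ is biconnected, or there are an ultrahomogeneous digraph $\mathbb{Y}$ and a cardinal $\kappa>1$ such that $\mathbb{X}$ is isomorphic to $\bigcup_\kappa\mathbb{Y}_e$, $(\bigcup_\kappa\mathbb{Y}_e)_{re}$, $(\bigcup_\kappa\mathbb{Y}_e)^c$ or $((\bigcup_\kappa\mathbb{Y}_e)_{re})^c$.
   Context: A binary structure is a pair $\mathbb{X}=\langle X,\rho\rangle$ with $\rho$ a binary relation on the set $X$; it is called reflexive (irreflexive) if $\rho$ is. It is ultrahomogeneous iff every isomorphism between finite substructures of $\mathbb{X}$ extends to an automorphism of $\mathbb{X}$. Let $\Delta_X$ be the diagonal of $X$. $\mathbb{X}$ is connected iff $|X/\rho_{rst}|=1$, where $\rho_{rst}$ is the transitive closure of $\Delta_X\cup\rho\cup\rho^{-1}$ (the smallest equivalence relation containing $\rho$). The complement is $\mathbb{X}^c=\langle X,X^2\setminus\rho\rangle$ and the reflexification is $\mathbb{X}_{re}=\langle X,\rho\cup\Delta_X\rangle$. $\mathbb{X}$ is biconnected iff both $\mathbb{X}$ and $\mathbb{X}^c$ are connected. A digraph is a binary structure whose relation is irreflexive and asymmetric (for all $x,y$: $\neg x\rho x$, and $\neg x\rho y$ or $\neg y\rho x$). The enlargement of $\mathbb{X}$ is $\mathbb{X}_e=\langle X,\rho_e\rangle$, where $x\,\rho_e\,y$ iff $x\rho y$ or ($x\neq y$ and $\neg x\rho y$ and $\neg y\rho x$). $\bigcup_\kappa\mathbb{Z}$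 denotes the disjoint union of $\kappa$ copies of $\mathbb{Z}$ (with no relations between different copies). *)

theory Defs
  imports Main
begin

unbundle cardinal_syntax

type_synonym 'a bstr = "'a set \<times> ('a \<times> 'a) set"

fun binary_structure :: "'a bstr \<Rightarrow> bool" where
  "binary_structure (X, \<rho>) \<longleftrightarrow> \<rho> \<subseteq> X \<times> X"

fun reflexive :: "'a bstr \<Rightarrow> bool" where
  "reflexive (X, \<rho>) \<longleftrightarrow> refl_on X \<rho>"

fun irreflexive :: "'a bstr \<Rightarrow> bool" where
  "irreflexive (X, \<rho>) \<longleftrightarrow> irrefl_on X \<rho>"

fun isomorphism :: "'a bstr \<Rightarrow> 'b bstr \<Rightarrow> ('a \<Rightarrow> 'b) \<Rightarrow> bool" where
  "isomorphism (X, \<rho>) (Y, \<sigma>) f \<longleftrightarrow>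
     bij_betw f X Y \<and> (\<forall>x\<in>X. \<forall>y\<in>X. (x, y) \<in> \<rho> \<longleftrightarrow> (f x, f y) \<in> \<sigma>)"

definition isomorphic :: "'a bstr \<Rightarrow> 'b bstr \<Rightarrow> bool" where
  "isomorphic S T \<longleftrightarrow> (\<exists>f. isomorphism S T f)"

definition automorphism :: "'a bstr \<Rightarrow> ('a \<Rightarrow> 'a) \<Rightarrow> bool" where
  "automorphism S f \<longleftrightarrow> isomorphism S S f"

fun substructure :: "'a bstr \<Rightarrow> 'a set \<Rightarrow> 'a bstr" where
  "substructure (X, \<rho>) A = (A, \<rho> \<inter> (A \<times> A))"

definition ultrahomogeneous :: "'a bstr \<Rightarrow> bool" where
  "ultrahomogeneous S \<longleftrightarrow>
     (\<forall>A B f. finite A \<and> A \<subseteq> fst S \<and> finite B \<and> B \<subseteq> fst S \<and>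
        isomorphism (substructure S A) (substructure S B) f \<longrightarrow>
        (\<exists>g. automorphism S g \<and> (\<forall>x\<in>A. g x = f x)))"

fun rst :: "'a bstr \<Rightarrow> ('a \<times> 'a) set" where
  "rst (X, \<rho>) = (Id_on X \<union> \<rho> \<union> \<rho>\<inverse>)\<^sup>+"

definition connected :: "'a bstr \<Rightarrow> bool" where
  "connected S \<longleftrightarrow> card (fst S // rst S) = 1"

fun complement :: "'a bstr \<Rightarrow> 'a bstr" where
  "complement (X, \<rho>) = (X, X \<times> X - \<rho>)"

fun reflexification :: "'a bstr \<Rightarrow> 'a bstr" where
  "reflexification (X, \<rho>) = (X, \<rho> \<union> Id_on X)"

definition biconnected :: "'a bstr \<Rightarrow> bool" where
  "biconnected S \<longleftrightarrow> connected S \<and> connected (complement S)"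

fun digraph :: "'a bstr \<Rightarrow> bool" where
  "digraph (X, \<rho>) \<longleftrightarrow> binary_structure (X, \<rho>) \<and> irrefl_on X \<rho> \<and> asym_on X \<rho>"

fun enlargement :: "'a bstr \<Rightarrow> 'a bstr" where
  "enlargement (X, \<rho>) =
     (X, {(x, y) \<in> X \<times> X. (x, y) \<in> \<rho> \<or> (x \<noteq> y \<and> (x, y) \<notin> \<rho> \<and> (y, x) \<notin> \<rho>)})"

text \<open>The copies are indexed by the field of the cardinal \<open>\<kappa>\<close>, a cardinal being an order
  relation satisfying \<^const>\<open>Card_order\<close>. For a structure over \<open>'a\<close>, cardinals over
  \<open>'a set\<close> suffice to count its components, which are subsets of its carrier; moreover there is
  always a cardinal greater than one over \<open>'a set\<close>.\<close>

fun disjoint_copies :: "'k rel \<Rightarrow> 'a bstr \<Rightarrow> ('k \<times> 'a) bstr" where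
  "disjoint_copies \<kappa> (X, \<rho>) =
     (Field \<kappa> \<times> X, {((i, x), (j, y)) |i j x y. i \<in> Field \<kappa> \<and> j = i \<and> (x, y) \<in> \<rho>})"

end

theory Submission imports Defs begin

text \<open>
  If \<open>X\<close> is not biconnected, then \<open>X\<close> or its complement is not connected. Complementation, and
  deleting the diagonal of a reflexive structure, keep the bijections that preserve the relation and
  hence ultrahomogeneity (\<open>ultrahomogeneous_cong\<close>); moreover the diagonal does not affect the
  components. Undoing these two operations produces the four shapes, so it remains to see that an
  irreflexive ultrahomogeneous structure that is not connected is a disjoint union of copies of some
  \<open>Y\<^sub>e\<close>.

  There, two distinct points \<open>x, y\<close> of one component are always related, in at least one direction:
  otherwise fixing \<open>x\<close> and sending \<open>y\<close> to a point of another component would be an isomorphism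
  between finite substructures, but an automorphism extending it would tear a component apart
  (\<open>related_in_component\<close>). Hence on a component only the one-way arcs carry information, and \<open>\<rho>\<close> is
  recovered from them as an enlargement (\<open>enlargement_one_way\<close>). All components are isomorphic because
  any one-point map extends to an automorphism (\<open>components_isomorphic\<close>), and the digraph of one-way
  arcs on a component inherits ultrahomogeneity because an automorphism that sends some point of a
  component into that component maps the component onto itself
  (\<open>ultrahomogeneous_component\<close>).
\<close>

section \<open>Isomorphisms and ultrahomogeneity\<close>

lemma isomorphism_substructure_iff:
  "isomorphism (substructure (X, \<rho>) A) (substructure (Y, \<sigma>) B) f \<longleftrightarrow>
     bij_betw f A B \<and> (\<forall>x\<in>A. \<forall>y\<in>A. (x, y) \<in> \<rho> \<longleftrightarrow> (f x, f y) \<in> \<sigma>)"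
  by (auto simp: bij_betw_def)

lemma isomorphism_inv_into:
  assumes "isomorphism (X, \<rho>) (Y, \<sigma>) f"
  shows "isomorphism (Y, \<sigma>) (X, \<rho>) (inv_into X f)"
proof -
  have f: "bij_betw f X Y" using assms by simp
  have "inv_into X f y \<in> X" "f (inv_into X f y) = y" if "y \<in> Y" for y
    using f that by (auto simp: bij_betw_def inv_into_into f_inv_into_f)
  then show ?thesis using assms bij_betw_inv_into[OF f] by simp
qed

lemma isomorphic_complement:
  assumes "isomorphic S T"
  shows "isomorphic (complement S) (complement T)"
proof -
  obtain X \<rho> Y \<sigma> where "S = (X, \<rho>)" "T = (Y, \<sigma>)" by (metis surj_pair)
  with assms show ?thesis by (auto simp: isomorphic_def bij_betw_def)
qed

lemma isomorphic_reflexification: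
  assumes "isomorphic S T"
  shows "isomorphic (reflexification S) (reflexification T)"
proof -
  obtain X \<rho> Y \<sigma> where ST: "S = (X, \<rho>)" "T = (Y, \<sigma>)" by (metis surj_pair)
  with assms obtain f where "isomorphism (X, \<rho>) (Y, \<sigma>) f" by (auto simp: isomorphic_def)
  then have "isomorphism (reflexification (X, \<rho>)) (reflexification (Y, \<sigma>)) f"
    by (auto simp: bij_betw_def inj_on_def)
  then show ?thesis using ST by (auto simp: isomorphic_def)
qed

lemma complement_complement:
  assumes "binary_structure S"
  shows "complement (complement S) = S"
  using assms by (cases S) auto

lemma ultrahomogeneousE:
  assumes "ultrahomogeneous (X, \<rho>)" "finite A" "A \<subseteq> X" "B \<subseteq> X" "bij_betw f A B"
    and "\<And>x y. x \<in> A \<Longrightarrow> y \<in> A \<Longrightarrow> (x, y) \<in> \<rho> \<longleftrightarrow> (f x, f y) \<in> \<rho>"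
  obtains g where "isomorphism (X, \<rho>) (X, \<rho>) g" "\<And>x. x \<in> A \<Longrightarrow> g x = f x"
proof -
  have "finite B" using assms bij_betw_finite by blast
  moreover have "isomorphism (substructure (X, \<rho>) A) (substructure (X, \<rho>) B) f"
    unfolding isomorphism_substructure_iff using assms(5,6) by blast
  ultimately have "\<exists>g. automorphism (X, \<rho>) g \<and> (\<forall>x\<in>A. g x = f x)"
    using assms(1-4) unfolding ultrahomogeneous_def fst_conv by blast
  then obtain g where "automorphism (X, \<rho>) g" "\<forall>x\<in>A. g x = f x" by (elim exE conjE)
  then show ?thesis using that[of g] unfolding automorphism_def by simp
qed

text \<open>Ultrahomogeneity depends on the relation only through the bijections that preserve it, so it
  passes to any relation that has the same ones.\<close>

lemma ultrahomogeneous_cong: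
  assumes "ultrahomogeneous (X, \<rho>)"
    and same: "\<And>A B f. A \<subseteq> X \<Longrightarrow> B \<subseteq> X \<Longrightarrow> bij_betw f A B \<Longrightarrow>
      (\<forall>x\<in>A. \<forall>y\<in>A. (x, y) \<in> \<rho> \<longleftrightarrow> (f x, f y) \<in> \<rho>) \<longleftrightarrow>
      (\<forall>x\<in>A. \<forall>y\<in>A. (x, y) \<in> \<sigma> \<longleftrightarrow> (f x, f y) \<in> \<sigma>)"
  shows "ultrahomogeneous (X, \<sigma>)"
  unfolding ultrahomogeneous_def
proof (intro allI impI, elim conjE)
  fix A B f
  assume A: "finite A" "A \<subseteq> fst (X, \<sigma>)" and B: "B \<subseteq> fst (X, \<sigma>)"
    and f: "isomorphism (substructure (X, \<sigma>) A) (substructure (X, \<sigma>) B) f"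
  have bij: "bij_betw f A B"
    and "\<forall>x\<in>A. \<forall>y\<in>A. (x, y) \<in> \<sigma> \<longleftrightarrow> (f x, f y) \<in> \<sigma>"
    using f unfolding isomorphism_substructure_iff by auto
  then have "\<forall>x\<in>A. \<forall>y\<in>A. (x, y) \<in> \<rho> \<longleftrightarrow> (f x, f y) \<in> \<rho>"
    using same[of A B f] A B by simp
  then obtain g where g: "isomorphism (X, \<rho>) (X, \<rho>) g" "\<And>x. x \<in> A \<Longrightarrow> g x = f x"
    using ultrahomogeneousE[OF assms(1), of A B f] A B bij by auto
  then have "automorphism (X, \<sigma>) g"
    using same[of X X g] by (simp add: automorphism_def)
  then show "\<exists>g. automorphism (X, \<sigma>) g \<and> (\<forall>x\<in>A. g x = f x)"
    using g(2) by (intro exI[of _ g]) simp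
qed

lemma ultrahomogeneous_complement:
  assumes "ultrahomogeneous S"
  shows "ultrahomogeneous (complement S)"
proof -
  obtain X \<rho> where S: "S = (X, \<rho>)" by (metis surj_pair)
  have "ultrahomogeneous (X, X \<times> X - \<rho>)"
  proof (rule ultrahomogeneous_cong[of X \<rho>])
    fix A B f assume "A \<subseteq> X" "B \<subseteq> X" "bij_betw f A B"
    then have "x \<in> X" "f x \<in> X" if "x \<in> A" for x
      using that by (auto simp: bij_betw_def)
    then show "(\<forall>x\<in>A. \<forall>y\<in>A. (x, y) \<in> \<rho> \<longleftrightarrow> (f x, f y) \<in> \<rho>) \<longleftrightarrow>
      (\<forall>x\<in>A. \<forall>y\<in>A. (x, y) \<in> X \<times> X - \<rho> \<longleftrightarrow> (f x, f y) \<in> X \<times> X - \<rho>)"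
      by auto
  qed (use assms S in simp)
  then show ?thesis using S by simp
qed

lemma ultrahomogeneous_Diff_Id:
  assumes "ultrahomogeneous (X, \<rho>)" and "refl_on X \<rho>"
  shows "ultrahomogeneous (X, \<rho> - Id)"
proof (rule ultrahomogeneous_cong[OF assms(1)])
  fix A B f assume *: "A \<subseteq> X" "B \<subseteq> X" "bij_betw f A B"
  have "(x, x) \<in> \<rho>" "(f x, f x) \<in> \<rho>" if "x \<in> A" for x
    using * that assms(2) by (auto simp: bij_betw_def refl_on_def)
  moreover have "f x = f y \<longleftrightarrow> x = y" if "x \<in> A" "y \<in> A" for x y
    using * that by (auto simp: bij_betw_def inj_on_def)
  ultimately have "((x, y) \<in> \<rho> \<longleftrightarrow> (f x, f y) \<in> \<rho>) \<longleftrightarrow>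
      ((x, y) \<in> \<rho> - Id \<longleftrightarrow> (f x, f y) \<in> \<rho> - Id)" if "x \<in> A" "y \<in> A" for x y
    using that by (cases "x = y") simp_all
  then show "(\<forall>x\<in>A. \<forall>y\<in>A. (x, y) \<in> \<rho> \<longleftrightarrow> (f x, f y) \<in> \<rho>) \<longleftrightarrow>
      (\<forall>x\<in>A. \<forall>y\<in>A. (x, y) \<in> \<rho> - Id \<longleftrightarrow> (f x, f y) \<in> \<rho> - Id)"
    by (intro ball_cong refl)
qed

section \<open>Components\<close>

lemma equiv_rst:
  assumes "\<rho> \<subseteq> X \<times> X"
  shows "equiv X (rst (X, \<rho>))"
proof (rule equivI)
  have "(Id_on X \<union> \<rho> \<union> \<rho>\<inverse>)\<^sup>+ \<subseteq> X \<times> X"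
    using assms by (intro trancl_subset_Sigma) auto
  then show "rst (X, \<rho>) \<subseteq> X \<times> X" by simp
  show "refl_on X (rst (X, \<rho>))" by (auto simp: refl_on_def)
  have "sym (Id_on X \<union> \<rho> \<union> \<rho>\<inverse>)" by (auto simp: sym_def)
  then show "sym (rst (X, \<rho>))" by (simp add: sym_trancl)
  show "trans (rst (X, \<rho>))" by simp
qed

lemma rst_Diff_Id:
  assumes "\<rho> \<subseteq> X \<times> X"
  shows "rst (X, \<rho> - Id) = rst (X, \<rho>)"
proof -
  have "Id_on X \<union> (\<rho> - Id) \<union> (\<rho> - Id)\<inverse> = Id_on X \<union> \<rho> \<union> \<rho>\<inverse>"
    using assms by auto
  then show ?thesis by simp
qed

lemma isomorphism_rst:
  assumes f: "isomorphism (X, \<rho>) (Y, \<sigma>) f" and "\<rho> \<subseteq> X \<times> X" and "(x, y) \<in> rst (X, \<rho>)"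
  shows "(f x, f y) \<in> rst (Y, \<sigma>)"
proof -
  have arc: "(f u, f v) \<in> Id_on Y \<union> \<sigma> \<union> \<sigma>\<inverse>" if "(u, v) \<in> Id_on X \<union> \<rho> \<union> \<rho>\<inverse>" for u v
    using f assms(2) that by (auto simp: bij_betw_def)
  have "(x, y) \<in> (Id_on X \<union> \<rho> \<union> \<rho>\<inverse>)\<^sup>+" using assms(3) by simp
  then have "(f x, f y) \<in> (Id_on Y \<union> \<sigma> \<union> \<sigma>\<inverse>)\<^sup>+"
  proof (induction rule: trancl_induct)
    case (base y)
    then show ?case using arc by blast
  next
    case (step y z)
    then show ?case using arc by (meson trancl.trancl_into_trancl)
  qed
  then show ?thesis by simp
qed

lemma quotient_eq_class:
  assumes "equiv A r" "C \<in> A // r" "x \<in> C"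
  shows "C = r `` {x}"
proof -
  obtain y where "C = r `` {y}" using assms(2) by (rule quotientE)
  then show ?thesis using equiv_class_eq[OF assms(1), of y x] assms(3) by simp
qed

lemma isomorphism_image_component:
  assumes g: "isomorphism (X, \<rho>) (X, \<rho>) g" and \<rho>: "\<rho> \<subseteq> X \<times> X"
    and C: "C \<in> X // rst (X, \<rho>)" "x \<in> C" and D: "D \<in> X // rst (X, \<rho>)" "g x \<in> D"
  shows "g ` C = D"
proof -
  note E = equiv_rst[OF \<rho>]
  have Ceq: "C = rst (X, \<rho>) `` {x}" and Deq: "D = rst (X, \<rho>) `` {g x}"
    using quotient_eq_class[OF E] C D by simp_all
  have CX: "C \<subseteq> X" and DX: "D \<subseteq> X"
    using in_quotient_imp_subset[OF E] C D by simp_all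
  have "D \<subseteq> g ` C"
  proof
    fix d assume d: "d \<in> D"
    let ?h = "inv_into X g"
    have inj: "inj_on g X" and gX: "g ` X = X" using g by (auto simp: bij_betw_def)
    have "(g x, d) \<in> rst (X, \<rho>)" using d unfolding Deq by (rule ImageE) simp
    then have "(?h (g x), ?h d) \<in> rst (X, \<rho>)"
      by (rule isomorphism_rst[OF isomorphism_inv_into[OF g] \<rho>])
    moreover have "?h (g x) = x" using inj C(2) CX by (intro inv_into_f_f) auto
    ultimately have "?h d \<in> C" unfolding Ceq by (intro ImageI[of x]) simp_all
    moreover have "g (?h d) = d" using gX d DX by (intro f_inv_into_f) auto
    ultimately show "d \<in> g ` C" by (intro image_eqI[of _ _ "?h d"]) simp_all
  qed
  moreover have "g ` C \<subseteq> D"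
  proof (rule image_subsetI)
    fix c assume "c \<in> C"
    then have "(x, c) \<in> rst (X, \<rho>)" unfolding Ceq by (rule ImageE) simp
    then show "g c \<in> D"
      unfolding Deq by (intro ImageI[of "g x"] isomorphism_rst[OF g \<rho>]) simp_all
  qed
  ultimately show ?thesis by (rule equalityI[rotated])
qed

lemma isomorphism_substructure_image:
  assumes "isomorphism (X, \<rho>) (Y, \<sigma>) g" "A \<subseteq> X"
  shows "isomorphism (substructure (X, \<rho>) A) (substructure (Y, \<sigma>) (g ` A)) g"
  unfolding isomorphism_substructure_iff
  using assms by (auto simp: bij_betw_def subset_iff intro: inj_on_subset)

text \<open>The empty partial map is the reason for a case distinction: an automorphism extending it need
  not respect the component, so there the identity serves instead.\<close>

lemma ultrahomogeneous_component:
  assumes uh: "ultrahomogeneous (X, \<rho>)" and \<rho>: "\<rho> \<subseteq> X \<times> X" and C: "C \<in> X // rst (X, \<rho>)"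
  shows "ultrahomogeneous (substructure (X, \<rho>) C)"
  unfolding ultrahomogeneous_def
proof (intro allI impI, elim conjE)
  let ?S = "substructure (X, \<rho>) C"
  fix A B f
  assume A: "finite A" "A \<subseteq> fst ?S" and B: "B \<subseteq> fst ?S"
    and f: "isomorphism (substructure ?S A) (substructure ?S B) f"
  have CX: "C \<subseteq> X" using in_quotient_imp_subset[OF equiv_rst[OF \<rho>] C] .
  have AC: "A \<subseteq> C" and BC: "B \<subseteq> C" using A B by auto
  have bij: "bij_betw f A B" using f by simp
  have fC: "x \<in> C \<and> f x \<in> C" if "x \<in> A" for x using that AC BC bij by (auto simp: bij_betw_def)
  have pres: "(x, y) \<in> \<rho> \<longleftrightarrow> (f x, f y) \<in> \<rho>" if "x \<in> A" "y \<in> A" for x y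
    using f fC that unfolding substructure.simps isomorphism.simps
    by (auto simp: bij_betw_def)
  show "\<exists>g. automorphism ?S g \<and> (\<forall>x\<in>A. g x = f x)"
  proof (cases "A = {}")
    case True
    have "automorphism ?S id" by (simp add: automorphism_def)
    with True show ?thesis by (intro exI[of _ id]) simp
  next
    case False
    then obtain a where a: "a \<in> A" by blast
    obtain g where g: "isomorphism (X, \<rho>) (X, \<rho>) g" "\<And>x. x \<in> A \<Longrightarrow> g x = f x"
      using ultrahomogeneousE[OF uh A(1) _ _ bij] pres AC BC CX by (metis subset_trans)
    have "g ` C = C"
      using isomorphism_image_component[OF g(1) \<rho> C _ C, of a] fC[OF a] g(2)[OF a] by simp
    then have "automorphism ?S g"
      using isomorphism_substructure_image[OF g(1) CX] by (simp only: automorphism_def)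
    then show ?thesis using g(2) by (intro exI[of _ g]) simp
  qed
qed

lemma components_isomorphic:
  assumes uh: "ultrahomogeneous (X, \<rho>)" and \<rho>: "\<rho> \<subseteq> X \<times> X" and irr: "irrefl_on X \<rho>"
    and C: "C \<in> X // rst (X, \<rho>)" and D: "D \<in> X // rst (X, \<rho>)"
  shows "isomorphic (substructure (X, \<rho>) C) (substructure (X, \<rho>) D)"
proof -
  note E = equiv_rst[OF \<rho>]
  have CX: "C \<subseteq> X" and DX: "D \<subseteq> X" using in_quotient_imp_subset[OF E] C D by blast+
  obtain c d where c: "c \<in> C" and d: "d \<in> D"
    using in_quotient_imp_non_empty[OF E] C D by blast
  have "bij_betw (\<lambda>_. d) {c} {d}" by (simp add: bij_betw_def)
  moreover have "(x, y) \<in> \<rho> \<longleftrightarrow> (d, d) \<in> \<rho>" if "x \<in> {c}" "y \<in> {c}" for x y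
    using that irr c d CX DX by (auto simp: irrefl_on_def)
  ultimately obtain g where g: "isomorphism (X, \<rho>) (X, \<rho>) g" "\<And>x. x \<in> {c} \<Longrightarrow> g x = d"
    using ultrahomogeneousE[OF uh, of "{c}" "{d}" "\<lambda>_. d"] c d CX DX by blast
  then have "g ` C = D" using isomorphism_image_component[OF g(1) \<rho> C c D] d by simp
  then show ?thesis
    using isomorphism_substructure_image[OF g(1) CX] unfolding isomorphic_def by metis
qed

text \<open>If \<open>x\<close> and \<open>y\<close> were unrelated, the pair \<open>x, y\<close> would look like the pair \<open>x, z\<close> with \<open>z\<close> in
  another component, and an automorphism fixing \<open>x\<close> cannot move \<open>y\<close> there.\<close>

lemma related_in_component:
  assumes uh: "ultrahomogeneous (X, \<rho>)" and \<rho>: "\<rho> \<subseteq> X \<times> X" and irr: "irrefl_on X \<rho>"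
    and C: "C \<in> X // rst (X, \<rho>)" and D: "D \<in> X // rst (X, \<rho>)" and "C \<noteq> D"
    and x: "x \<in> C" and y: "y \<in> C" and "x \<noteq> y"
  shows "(x, y) \<in> \<rho> \<or> (y, x) \<in> \<rho>"
proof (rule ccontr)
  assume un: "\<not> ?thesis"
  note E = equiv_rst[OF \<rho>]
  have CX: "C \<subseteq> X" and DX: "D \<subseteq> X" using in_quotient_imp_subset[OF E] C D by blast+
  obtain z where z: "z \<in> D" using in_quotient_imp_non_empty[OF E] D by blast
  have disj: "C \<inter> D = {}" using quotient_disj[OF E C D] \<open>C \<noteq> D\<close> by blast
  have zC: "z \<notin> C" and "x \<noteq> z" using z x disj by auto
  have "(x, z) \<notin> rst (X, \<rho>)"
    using zC in_quotient_imp_closed[OF E C x] by blast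
  then have unz: "(x, z) \<notin> \<rho>" "(z, x) \<notin> \<rho>" by auto
  let ?f = "\<lambda>u. if u = y then z else u"
  have "bij_betw ?f {x, y} {x, z}"
    using \<open>x \<noteq> y\<close> \<open>x \<noteq> z\<close> by (auto simp: bij_betw_def inj_on_def)
  moreover have "(u, v) \<in> \<rho> \<longleftrightarrow> (?f u, ?f v) \<in> \<rho>" if "u \<in> {x, y}" "v \<in> {x, y}" for u v
    using that un unz irr x y z CX DX \<open>x \<noteq> y\<close> by (auto simp: irrefl_on_def)
  ultimately obtain g where g: "isomorphism (X, \<rho>) (X, \<rho>) g" "\<And>u. u \<in> {x, y} \<Longrightarrow> g u = ?f u"
    using ultrahomogeneousE[OF uh, of "{x, y}" "{x, z}" ?f] x y z CX DX by blast
  have "g x = x" "g y = z" using g(2) \<open>x \<noteq> y\<close> by auto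
  then have "g ` C = C" using isomorphism_image_component[OF g(1) \<rho> C x C] x by simp
  then show False using \<open>g y = z\<close> y zC by blast
qed

section \<open>Recovering a component from its one-way arcs\<close>

definition one_way :: "'a bstr \<Rightarrow> 'a bstr" where
  "one_way S = (fst S, snd S - (snd S)\<inverse>)"

lemma digraph_one_way:
  assumes "binary_structure S"
  shows "digraph (one_way S)"
  using assms by (cases S) (auto simp: one_way_def irrefl_on_def asym_on_def)

text \<open>When distinct points are always related, two of them without a one-way arc are related in
  both directions, which is exactly what the enlargement restores.\<close>

lemma enlargement_one_way:
  assumes "\<rho> \<subseteq> C \<times> C" "irrefl_on C \<rho>"
    and "\<And>x y. x \<in> C \<Longrightarrow> y \<in> C \<Longrightarrow> x \<noteq> y \<Longrightarrow> (x, y) \<in> \<rho> \<or> (y, x) \<in> \<rho>"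
  shows "enlargement (one_way (C, \<rho>)) = (C, \<rho>)"
proof -
  have "((x, y) \<in> \<rho> - \<rho>\<inverse> \<or> x \<noteq> y \<and> (x, y) \<notin> \<rho> - \<rho>\<inverse> \<and> (y, x) \<notin> \<rho> - \<rho>\<inverse>) \<longleftrightarrow> (x, y) \<in> \<rho>"
    if "x \<in> C" "y \<in> C" for x y
    using assms(3)[OF that] that assms(2) by (auto simp: irrefl_on_def)
  then show ?thesis using assms(1) by (auto simp: one_way_def)
qed

text \<open>A bijection that preserves the one-way arcs also preserves the two-way ones, being the
  remaining pairs of distinct points; so both relations have the same partial isomorphisms.\<close>

lemma ultrahomogeneous_one_way:
  assumes uh: "ultrahomogeneous (C, \<rho>)" and irr: "irrefl_on C \<rho>"
    and tot: "\<And>x y. x \<in> C \<Longrightarrow> y \<in> C \<Longrightarrow> x \<noteq> y \<Longrightarrow> (x, y) \<in> \<rho> \<or> (y, x) \<in> \<rho>"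
  shows "ultrahomogeneous (one_way (C, \<rho>))"
proof -
  have "ultrahomogeneous (C, \<rho> - \<rho>\<inverse>)"
  proof (rule ultrahomogeneous_cong[OF uh])
    fix A B f assume *: "A \<subseteq> C" "B \<subseteq> C" "bij_betw f A B"
    have fC: "x \<in> C" "f x \<in> C" if "x \<in> A" for x using * that by (auto simp: bij_betw_def)
    have inj: "f x = f y \<longleftrightarrow> x = y" if "x \<in> A" "y \<in> A" for x y
      using * that by (auto simp: bij_betw_def inj_on_def)
    \<comment> \<open>\<open>\<rho>\<close> is definable from the one-way arcs: it relates distinct points unless the arc between
      them runs only backwards.\<close>
    have rec: "(x, y) \<in> \<rho> \<longleftrightarrow> x \<noteq> y \<and> (y, x) \<notin> \<rho> - \<rho>\<inverse>" if "x \<in> C" "y \<in> C" for x y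
      using tot[OF that] that irr by (auto simp: irrefl_on_def)
    show "(\<forall>x\<in>A. \<forall>y\<in>A. (x, y) \<in> \<rho> \<longleftrightarrow> (f x, f y) \<in> \<rho>) \<longleftrightarrow>
      (\<forall>x\<in>A. \<forall>y\<in>A. (x, y) \<in> \<rho> - \<rho>\<inverse> \<longleftrightarrow> (f x, f y) \<in> \<rho> - \<rho>\<inverse>)" (is "?P \<longleftrightarrow> ?Q")
    proof
      assume ?P then show ?Q by auto
    next
      assume Q: ?Q
      show ?P
      proof (intro ballI)
        fix x y assume xy: "x \<in> A" "y \<in> A"
        show "(x, y) \<in> \<rho> \<longleftrightarrow> (f x, f y) \<in> \<rho>"
          unfolding rec[OF fC(1)[OF xy(1)] fC(1)[OF xy(2)]] rec[OF fC(2)[OF xy(1)] fC(2)[OF xy(2)]]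
          using Q xy inj by blast
      qed
    qed
  qed
  then show ?thesis by (simp add: one_way_def)
qed

section \<open>Structures that are not connected\<close>

text \<open>Choosing an isomorphism onto the common model for each component, a point is coded by its
  component and the image under the isomorphism chosen there; no arc leaves a component. The index
  set is the quotient itself, so the cardinal is the number of components.\<close>

lemma isomorphic_disjoint_copies:
  assumes \<rho>: "\<rho> \<subseteq> X \<times> X"
    and iso: "\<And>D. D \<in> X // rst (X, \<rho>) \<Longrightarrow> isomorphic (substructure (X, \<rho>) D) (C, \<sigma>)"
  shows "isomorphic (X, \<rho>) (disjoint_copies (card_of (X // rst (X, \<rho>))) (C, \<sigma>))"
proof -
  let ?Q = "X // rst (X, \<rho>)"
  note E = equiv_rst[OF \<rho>]
  let ?c = "\<lambda>x. rst (X, \<rho>) `` {x}"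
  obtain h where h: "\<And>D. D \<in> ?Q \<Longrightarrow> isomorphism (substructure (X, \<rho>) D) (C, \<sigma>) (h D)"
    using iso unfolding isomorphic_def by metis
  have hb: "bij_betw (h D) D C" if "D \<in> ?Q" for D using h[OF that] by simp
  have hp: "(x, y) \<in> \<rho> \<longleftrightarrow> (h D x, h D y) \<in> \<sigma>" if "D \<in> ?Q" "x \<in> D" "y \<in> D" for D x y
    using h[OF that(1)] that by simp
  have cQ: "?c x \<in> ?Q" "x \<in> ?c x" if "x \<in> X" for x
    using quotientI[OF that] equiv_class_self[OF E that] .
  have cD: "?c x = D" "x \<in> X" if "D \<in> ?Q" "x \<in> D" for D x
    using quotient_eq_class[OF E that] in_quotient_imp_subset[OF E that(1)] that(2) by blast+
  let ?f = "\<lambda>x. (?c x, h (?c x) x)"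
  have "bij_betw ?f X (?Q \<times> C)"
    unfolding bij_betw_def
  proof
    show "inj_on ?f X"
    proof (rule inj_onI)
      fix x y assume xy: "x \<in> X" "y \<in> X" and "?f x = ?f y"
      then have "?c x = ?c y" "h (?c x) x = h (?c x) y" by auto
      then show "x = y" using hb[OF cQ(1)[OF xy(1)]] cQ(2) xy by (metis bij_betw_def inj_onD)
    qed
    show "?f ` X = ?Q \<times> C"
    proof
      show "?f ` X \<subseteq> ?Q \<times> C"
      proof
        fix p assume "p \<in> ?f ` X"
        then obtain x where x: "x \<in> X" "p = ?f x" by blast
        then have "h (?c x) x \<in> C" using bij_betwE[OF hb[OF cQ(1)]] cQ(2) by blast
        then show "p \<in> ?Q \<times> C" unfolding x(2) using cQ(1)[OF x(1)] by (intro SigmaI)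
      qed
      show "?Q \<times> C \<subseteq> ?f ` X"
      proof
        fix p assume "p \<in> ?Q \<times> C"
        then obtain D c where p: "p = (D, c)" "D \<in> ?Q" "c \<in> C" by blast
        then obtain x where "x \<in> D" "h D x = c" using hb by (metis bij_betw_def imageE)
        then show "p \<in> ?f ` X" using cD[OF p(2)] p by (intro image_eqI[of _ _ x]) auto
      qed
    qed
  qed
  moreover have "(x, y) \<in> \<rho> \<longleftrightarrow> ?c x = ?c y \<and> (h (?c x) x, h (?c y) y) \<in> \<sigma>"
    if xy: "x \<in> X" "y \<in> X" for x y
  proof -
    have "?c x = ?c y" if "(x, y) \<in> \<rho>"
    proof -
      have "(x, y) \<in> rst (X, \<rho>)" using that by auto
      then show ?thesis using E by (rule equiv_class_eq[rotated])
    qed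
    moreover have "(x, y) \<in> \<rho> \<longleftrightarrow> (h (?c x) x, h (?c y) y) \<in> \<sigma>" if "?c x = ?c y"
      using hp[OF cQ(1)[OF xy(1)], of x y] cQ(2) xy that by metis
    ultimately show ?thesis by blast
  qed
  ultimately have "isomorphism (X, \<rho>) (disjoint_copies (card_of ?Q) (C, \<sigma>)) ?f"
    unfolding disjoint_copies.simps isomorphism.simps Field_card_of
    using cQ(1) by (auto simp del: rst.simps)
  then show ?thesis unfolding isomorphic_def by blast
qed

lemma cone_less_card_of:
  assumes "a \<in> A" "b \<in> A" "a \<noteq> b"
  shows "cone <o card_of A"
proof -
  have "\<not> card_of A \<le>o card_of {()}"
  proof
    assume "card_of A \<le>o card_of {()}"
    then obtain f where "inj_on f A" "f ` A \<subseteq> {()}" unfolding card_of_ordLeq[symmetric] by blast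
    then show False using assms by (auto simp: inj_on_def)
  qed
  then show ?thesis unfolding cone_def
    by (simp add: not_ordLeq_iff_ordLess card_of_Well_order)
qed

lemma disconnected_irreflexive:
  fixes X :: "'a set"
  assumes \<rho>: "\<rho> \<subseteq> X \<times> X" and irr: "irrefl_on X \<rho>" and uh: "ultrahomogeneous (X, \<rho>)"
    and disc: "\<not> connected (X, \<rho>)"
  shows "\<exists>(Y :: 'a bstr) (\<kappa> :: 'a set rel).
    digraph Y \<and> ultrahomogeneous Y \<and> Card_order \<kappa> \<and> cone <o \<kappa> \<and>
    isomorphic (X, \<rho>) (disjoint_copies \<kappa> (enlargement Y))"
proof (cases "X = {}")
  \<comment> \<open>The empty structure is not connected but has no component to take \<open>Y\<close> from; it is the union of
    any number of empty structures.\<close>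
  case True
  let ?\<kappa> = "card_of (UNIV :: 'a set set)"
  have "cone <o ?\<kappa>" by (rule cone_less_card_of[of "{}" _ UNIV]) auto
  moreover have "isomorphic (X, \<rho>) (disjoint_copies ?\<kappa> (enlargement ({}, {})))"
    using True by (simp add: isomorphic_def bij_betw_def)
  moreover have "ultrahomogeneous ({} :: 'a set, {})"
    using uh True \<rho> by simp
  moreover have "digraph ({} :: 'a set, {})" by (simp add: irrefl_on_def asym_on_def)
  ultimately show ?thesis using card_of_Card_order by blast
next
  case False
  let ?Q = "X // rst (X, \<rho>)"
  note E = equiv_rst[OF \<rho>]
  obtain C where C: "C \<in> ?Q" using False by (metis ex_in_conv quotientI)
  have "?Q \<noteq> {C}" using disc unfolding connected_def by (metis fst_conv is_singletonI is_singleton_altdef)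
  then obtain D where D: "D \<in> ?Q" "C \<noteq> D" using C by blast
  have CX: "C \<subseteq> X" using in_quotient_imp_subset[OF E C] .
  define \<sigma> where "\<sigma> = \<rho> \<inter> C \<times> C"
  have sub: "substructure (X, \<rho>) C = (C, \<sigma>)" by (simp add: \<sigma>_def)
  have \<sigma>: "\<sigma> \<subseteq> C \<times> C" "irrefl_on C \<sigma>" using irr CX by (auto simp: \<sigma>_def irrefl_on_def)
  have tot: "(x, y) \<in> \<sigma> \<or> (y, x) \<in> \<sigma>" if "x \<in> C" "y \<in> C" "x \<noteq> y" for x y
    using related_in_component[OF uh \<rho> irr C D that] that by (simp add: \<sigma>_def)
  let ?Y = "one_way (C, \<sigma>)"
  have enl: "enlargement ?Y = (C, \<sigma>)" using \<sigma> tot by (rule enlargement_one_way)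
  have "digraph ?Y" using \<sigma> by (intro digraph_one_way) simp
  moreover have "ultrahomogeneous ?Y"
    using ultrahomogeneous_component[OF uh \<rho> C] \<sigma>(2) tot unfolding sub
    by (rule ultrahomogeneous_one_way)
  moreover have "cone <o card_of ?Q" using C D by (rule cone_less_card_of)
  moreover have "isomorphic (substructure (X, \<rho>) D) (C, \<sigma>)" if "D \<in> ?Q" for D
    using components_isomorphic[OF uh \<rho> irr that C] unfolding sub .
  then have "isomorphic (X, \<rho>) (disjoint_copies (card_of ?Q) (enlargement ?Y))"
    unfolding enl by (rule isomorphic_disjoint_copies[OF \<rho>])
  ultimately show ?thesis
    using card_of_Card_order by (intro exI[of _ ?Y] exI[of _ "card_of ?Q"] conjI)
qed

lemma disconnected:
  fixes S :: "'a bstr"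
  assumes bs: "binary_structure S" and ri: "reflexive S \<or> irreflexive S"
    and uh: "ultrahomogeneous S" and disc: "\<not> connected S"
  shows "\<exists>(Y :: 'a bstr) (\<kappa> :: 'a set rel).
    digraph Y \<and> ultrahomogeneous Y \<and> Card_order \<kappa> \<and> cone <o \<kappa> \<and>
    (isomorphic S (disjoint_copies \<kappa> (enlargement Y)) \<or>
     isomorphic S (reflexification (disjoint_copies \<kappa> (enlargement Y))))"
proof -
  obtain X \<rho> where S: "S = (X, \<rho>)" by (metis surj_pair)
  have \<rho>: "\<rho> \<subseteq> X \<times> X" using bs S by simp
  show ?thesis
  proof (cases "irrefl_on X \<rho>")
    case True
    then show ?thesis using disconnected_irreflexive[OF \<rho>] uh disc unfolding S by blast
  next
    case False
    then have refl: "refl_on X \<rho>" using ri S by simp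
    have "\<rho> - Id \<subseteq> X \<times> X" "irrefl_on X (\<rho> - Id)" using \<rho> by (auto simp: irrefl_on_def)
    moreover have "ultrahomogeneous (X, \<rho> - Id)"
      using ultrahomogeneous_Diff_Id uh refl unfolding S by blast
    moreover have "\<not> connected (X, \<rho> - Id)"
      using disc rst_Diff_Id[OF \<rho>] unfolding S connected_def by simp
    ultimately obtain Y :: "'a bstr" and \<kappa> :: "'a set rel" where
      Y: "digraph Y" "ultrahomogeneous Y" "Card_order \<kappa>" "cone <o \<kappa>"
        "isomorphic (X, \<rho> - Id) (disjoint_copies \<kappa> (enlargement Y))"
      using disconnected_irreflexive by blast
    have "reflexification (X, \<rho> - Id) = S"
      using refl \<rho> S by (auto simp: refl_on_def)
    then have "isomorphic S (reflexification (disjoint_copies \<kappa> (enlargement Y)))"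
      using isomorphic_reflexification[OF Y(5)] by simp
    then show ?thesis using Y by blast
  qed
qed

theorem theorem4p1:
  fixes X :: "'a bstr"
  assumes "binary_structure X"
    and "reflexive X \<or> irreflexive X"
    and "ultrahomogeneous X"
  shows "biconnected X \<or>
    (\<exists>(Y :: 'a bstr) (\<kappa> :: 'a set rel).
       digraph Y \<and> ultrahomogeneous Y \<and> Card_order \<kappa> \<and> cone <o \<kappa> \<and>
       (isomorphic X (disjoint_copies \<kappa> (enlargement Y)) \<or>
        isomorphic X (reflexification (disjoint_copies \<kappa> (enlargement Y))) \<or>
        isomorphic X (complement (disjoint_copies \<kappa> (enlargement Y))) \<or>
        isomorphic X (complement (reflexification (disjoint_copies \<kappa> (enlargement Y))))))"
proof (cases "connected X")
  case False
  then show ?thesis using disconnected[OF assms] by blast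
next
  case True
  show ?thesis
  proof (cases "connected (complement X)")
    case True
    then show ?thesis using \<open>connected X\<close> by (simp add: biconnected_def)
  next
    case False
    have "binary_structure (complement X)" by (cases X) auto
    moreover have "reflexive (complement X) \<or> irreflexive (complement X)"
      using assms(2) by (cases X) (auto simp: refl_on_def irrefl_on_def)
    ultimately obtain Y :: "'a bstr" and \<kappa> :: "'a set rel" where
      Y: "digraph Y" "ultrahomogeneous Y" "Card_order \<kappa>" "cone <o \<kappa>"
        "isomorphic (complement X) (disjoint_copies \<kappa> (enlargement Y)) \<or>
         isomorphic (complement X) (reflexification (disjoint_copies \<kappa> (enlargement Y)))"
      using disconnected[OF _ _ ultrahomogeneous_complement[OF assms(3)] False] by blast
    then show ?thesis
      using isomorphic_complement[of "complement X"] complement_complement[OF assms(1)] by metis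
  qed
qed

end
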